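(* Let the band matrix $A=(A_{k,\ell})_{k,\ell\ge 0}$ (with entries in $\mathbb{C}^{N\times N}$, $A_{k,\ell}=O$ for $\ell<k-s$ or $\ell>k+r$, and $A_{k,k+r}$, $A_{k+s,k}$ invertible for all $k\ge 0$) satisfy $\sup_{i,j\ge 0}\|A_{i,j}\|<\infty$. If $\lambda\in\Omega(A)$, then for all $i=1,\dots,r$ and $j=1,\dots,s$ $$\limsup_{k\to\infty}\|Q_k^{i}(\lambda)\|^{1/k}>1,\qquad \limsup_{k\to\infty}\|Q_k^{j,+}(\lambda)\|^{1/k}>1.$$
   Context: Fix positive integers $N,r,s$; $E$ and $O$ are the unit and zero matrices of order $N$. $\|\cdot\|$ is a fixed matrix norm on $\mathbb{C}^{N\times N}$. $I_i$ and $\mathbf{0}_{i\times j}$ denote the identity and zero block matrices of block sizes $i\times i$ and $i\times j$, with blocks in $\mathbb{C}^{N\times N}$. Band matrix: $A=(A_{k,\ell})_{k,\ell=0}^\infty$, $A_{k,\ell}\in\mathbb{C}^{N\times N}$, where for all $k\ge 0$: $A_{k,\ell}=O$ if $\ell<k-s$ or $\ell>k+r$, and $A_{k,k+r}$, $A_{k+s,k}$ are invertible. Entries with a negative index are defined by: for $k\ge 0>\ell$, $A_{k,\ell}=-E$ if $k-\ell=s$ and $A_{k,\ell}=O$ otherwise; for $k<0\le \ell$, $A_{k,\ell}=-E$ if $\ell-k=r$ and $A_{k,\ell}=O$ otherwise. For $\lambda\in\mathbb{C}$ consider, for all $k\ge 0$, the difference equations for $Y_k,Y_k^+\in\mathbb{C}^{N\times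 N}$: (D1) $A_{k,k-s}Y_{k-s}+A_{k,k-s+1}Y_{k-s+1}+\dots+A_{k,k+r}Y_{k+r}=\lambda Y_k$, where $(Y_k)_{k\ge -s}$; (D2) $Y^+_{k-r}A_{k-r,k}+Y^+_{k-r+1}A_{k-r+1,k}+\dots+Y^+_{k+s}A_{k+s,k}=\lambda Y_k^+$, where $(Y^+_k)_{k\ge -r}$. Polynomial solutions: $Q_k(\lambda)=(Q_k^1(\lambda),\dots,Q_k^r(\lambda))$, $k\ge -s$, is a block row each of whose components solves (D1); $Q_k^+(\lambda)$, $k\ge -r$, is the block column with entries $Q_k^{1,+}(\lambda),\dots,Q_k^{s,+}(\lambda)$, each solving (D2). All blocks are in $\mathbb{C}^{N\times N}$. Writing $Q_{j:k}$ for the block matrix with rows $Q_\ell$, $\ell=j,\dots,k$, and $Q^+_{j:k}$ for the block matrix with columns $Q^+_\ell$, $\ell=j,\dots,k$, they are determined by the initial conditions $Q_{0:r-1}=I_r$, $Q_{-s:-1}=\mathbf{0}_{s\times r}$; $Q^+_{0:s-1}=I_s$, $Q^+_{-r:-1}=\mathbf{0}_{s\times r}$. Operator: $l^2_N$ is the Hilbert space of square-summable sequences $u=(u_0,u_1,\dots)$ of column vectors $u_j\in\mathbb{C}^N$ with inner product $(u,v)=\sum_j v_j^*u_j$; under the boundedness assumption $A$ acts as a bounded operator on $l^2_N$. The resolvent set $\Omega(A)$ is the set of $\lambda\in\mathbb{C}$ for which $\lambda I-A$ has a bounded two-sided inverse on $l^2_N$. *)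

theory Defs
  imports "HOL-Analysis.Analysis"
begin

type_synonym 'n cmat = "((complex, 'n) vec, 'n) vec"

definition mscale :: "complex \<Rightarrow> 'n::finite cmat \<Rightarrow> 'n cmat" where
  "mscale c X = (\<chi> i. c *s (X $ i))"

(* Submultiplicativity is not required; in particular every submultiplicative
   matrix norm satisfies this predicate. *)
definition matrix_norm :: "('n::finite cmat \<Rightarrow> real) \<Rightarrow> bool" where
  "matrix_norm nrm \<longleftrightarrow>
     (\<forall>X. nrm X \<ge> 0) \<and> (\<forall>X. nrm X = 0 \<longleftrightarrow> X = 0) \<and>
     (\<forall>c X. nrm (mscale c X) = cmod c * nrm X) \<and>
     (\<forall>X Y. nrm (X + Y) \<le> nrm X + nrm Y)"

definition band_matrix :: "nat \<Rightarrow> nat \<Rightarrow> (nat \<Rightarrow> nat \<Rightarrow> 'n::finite cmat) \<Rightarrow> bool" where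
  "band_matrix r s A \<longleftrightarrow>
     (\<forall>k l. l + s < k \<or> k + r < l \<longrightarrow> A k l = 0) \<and>
     (\<forall>k. invertible (A k (k + r))) \<and> (\<forall>k. invertible (A (k + s) k))"

(* The entries at integer positions.  Positions with both indices negative never occur
   in the difference equations below; they are set to 0. *)
definition ext_entry ::
    "nat \<Rightarrow> nat \<Rightarrow> (nat \<Rightarrow> nat \<Rightarrow> 'n::finite cmat) \<Rightarrow> int \<Rightarrow> int \<Rightarrow> 'n cmat" where
  "ext_entry r s A k l =
     (if 0 \<le> k \<and> 0 \<le> l then A (nat k) (nat l)
      else if 0 \<le> k \<and> l < 0 then (if k - l = int s then - mat 1 else 0)
      else if k < 0 \<and> 0 \<le> l then (if l - k = int r then - mat 1 else 0)
      else 0)"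

(* Sequences (Y_k) with k \<ge> -s (right equation) or k \<ge> -r (left equation) are functions
   on int; their values at smaller indices are irrelevant. *)
definition right_solution ::
    "nat \<Rightarrow> nat \<Rightarrow> (nat \<Rightarrow> nat \<Rightarrow> 'n::finite cmat) \<Rightarrow> complex \<Rightarrow> (int \<Rightarrow> 'n cmat) \<Rightarrow> bool" where
  "right_solution r s A lam Y \<longleftrightarrow>
     (\<forall>k\<ge>0. (\<Sum>l = k - int s..k + int r. ext_entry r s A k l ** Y l) = mscale lam (Y k))"

definition left_solution ::
    "nat \<Rightarrow> nat \<Rightarrow> (nat \<Rightarrow> nat \<Rightarrow> 'n::finite cmat) \<Rightarrow> complex \<Rightarrow> (int \<Rightarrow> 'n cmat) \<Rightarrow> bool" where
  "left_solution r s A lam Y \<longleftrightarrow>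
     (\<forall>k\<ge>0. (\<Sum>l = k - int r..k + int s. Y l ** ext_entry r s A l k) = mscale lam (Y k))"

(* Q i lam k is the i-th block (i = 1..r) of the block row Q_k(lam);
   the initial conditions are Q_{0:r-1} = I_r and Q_{-s:-1} = 0. *)
definition right_fundamental ::
    "nat \<Rightarrow> nat \<Rightarrow> (nat \<Rightarrow> nat \<Rightarrow> 'n::finite cmat) \<Rightarrow> (nat \<Rightarrow> complex \<Rightarrow> int \<Rightarrow> 'n cmat) \<Rightarrow> bool" where
  "right_fundamental r s A Q \<longleftrightarrow>
     (\<forall>i\<in>{1..r}. \<forall>lam.
        right_solution r s A lam (Q i lam) \<and>
        (\<forall>k<r. Q i lam (int k) = (if k + 1 = i then mat 1 else 0)) \<and>
        (\<forall>k\<in>{- int s..-1}. Q i lam k = 0))"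

(* Qp j lam k is the j-th block (j = 1..s) of the block column Q^+_k(lam);
   the initial conditions are Q^+_{0:s-1} = I_s and Q^+_{-r:-1} = 0. *)
definition left_fundamental ::
    "nat \<Rightarrow> nat \<Rightarrow> (nat \<Rightarrow> nat \<Rightarrow> 'n::finite cmat) \<Rightarrow> (nat \<Rightarrow> complex \<Rightarrow> int \<Rightarrow> 'n cmat) \<Rightarrow> bool" where
  "left_fundamental r s A Qp \<longleftrightarrow>
     (\<forall>j\<in>{1..s}. \<forall>lam.
        left_solution r s A lam (Qp j lam) \<and>
        (\<forall>k<s. Qp j lam (int k) = (if k + 1 = j then mat 1 else 0)) \<and>
        (\<forall>k\<in>{- int r..-1}. Qp j lam k = 0))"

definition l2 :: "(nat \<Rightarrow> complex^'n::finite) set" where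
  "l2 = {u. summable (\<lambda>j. (norm (u j))\<^sup>2)}"

(* The norm induced by the inner product sum_j v_j^* u_j;
   norm on complex^'n is the Euclidean one. *)
definition l2_norm :: "(nat \<Rightarrow> complex^'n::finite) \<Rightarrow> real" where
  "l2_norm u = sqrt (\<Sum>j. (norm (u j))\<^sup>2)"

definition bounded_l2_operator ::
    "((nat \<Rightarrow> complex^'n::finite) \<Rightarrow> (nat \<Rightarrow> complex^'n)) \<Rightarrow> bool" where
  "bounded_l2_operator T \<longleftrightarrow>
     (\<forall>u\<in>l2. T u \<in> l2) \<and>
     (\<forall>u\<in>l2. \<forall>v\<in>l2. T (\<lambda>j. u j + v j) = (\<lambda>j. T u j + T v j)) \<and>
     (\<forall>c. \<forall>u\<in>l2. T (\<lambda>j. c *s u j) = (\<lambda>j. c *s T u j)) \<and>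
     (\<exists>C. \<forall>u\<in>l2. l2_norm (T u) \<le> C * l2_norm u)"

(* For a band matrix each of these series has only finitely many nonzero terms. *)
definition matrix_action ::
    "(nat \<Rightarrow> nat \<Rightarrow> 'n::finite cmat) \<Rightarrow> (nat \<Rightarrow> complex^'n) \<Rightarrow> (nat \<Rightarrow> complex^'n)" where
  "matrix_action A u = (\<lambda>k. \<Sum>l. A k l *v u l)"

definition shifted_action ::
    "complex \<Rightarrow> (nat \<Rightarrow> nat \<Rightarrow> 'n::finite cmat) \<Rightarrow> (nat \<Rightarrow> complex^'n) \<Rightarrow> (nat \<Rightarrow> complex^'n)" where
  "shifted_action lam A u = (\<lambda>k. lam *s u k - matrix_action A u k)"

(* Meaningful when the matrix acts as a bounded operator on l2. *)
definition resolvent_set :: "(nat \<Rightarrow> nat \<Rightarrow> 'n::finite cmat) \<Rightarrow> complex set" where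
  "resolvent_set A =
     {lam. \<exists>R. bounded_l2_operator R \<and>
        (\<forall>u\<in>l2. R (shifted_action lam A u) = u \<and> shifted_action lam A (R u) = u)}"

text \<open>The initial conditions do determine the two families of solutions: existence
  (so that the predicates above are satisfiable) and uniqueness on the relevant indices.\<close>

lemma forward_recursion_exists:
  fixes G :: "nat \<Rightarrow> (int \<Rightarrow> 'a) \<Rightarrow> 'a"
  assumes G: "\<And>n f g. (\<And>l. l < int (n + p) \<Longrightarrow> f l = g l) \<Longrightarrow> G n f = G n g"
  shows "\<exists>Y. (\<forall>k < int p. Y k = init k) \<and> (\<forall>n. Y (int (n + p)) = G n Y)"
proof -
  define F where "F = rec_nat init (\<lambda>n f. f(int (n + p) := G n f))"
  have F0: "F 0 = init" and FS: "F (Suc n) = (F n)(int (n + p) := G n (F n))" for n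
    by (simp_all add: F_def)
  have mono: "F (n + d) l = F n l" if "l < int (n + p)" for n d l
    using that by (induction d) (simp_all add: FS)
  define Y where "Y k = F (nat (k - int p + 1)) k" for k
  have Y: "Y l = F n l" if "l < int (n + p)" for n l
  proof -
    have le: "nat (l - int p + 1) \<le> n" using that by linarith
    have lt: "l < int (nat (l - int p + 1) + p)" by linarith
    show ?thesis
      using mono[OF lt, of "n - nat (l - int p + 1)"] le by (simp add: Y_def)
  qed
  have "Y k = init k" if "k < int p" for k
    using Y[of k 0] that by (simp add: F0)
  moreover have "Y (int (n + p)) = G n Y" for n
  proof -
    have "Y (int (n + p)) = F (Suc n) (int (n + p))" by (rule Y) simp
    also have "\<dots> = G n (F n)" by (simp add: FS)
    also have "\<dots> = G n Y" by (rule G) (simp add: Y)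
    finally show ?thesis .
  qed
  ultimately show ?thesis by blast
qed

lemma forward_recursion_unique:
  fixes Y Z :: "int \<Rightarrow> 'a"
  assumes init: "\<And>k. q \<le> k \<Longrightarrow> k < int p \<Longrightarrow> Y k = Z k"
    and step: "\<And>n. (\<And>l. q \<le> l \<Longrightarrow> l < int (n + p) \<Longrightarrow> Y l = Z l) \<Longrightarrow> Y (int (n + p)) = Z (int (n + p))"
    and "q \<le> k"
  shows "Y k = Z k"
proof -
  have "\<forall>l. q \<le> l \<and> l < int (n + p) \<longrightarrow> Y l = Z l" for n
  proof (induction n)
    case 0
    then show ?case using init by simp
  next
    case (Suc n)
    have eq: "Y (int (n + p)) = Z (int (n + p))" by (rule step) (use Suc in blast)
    show ?case
    proof (intro allI impI)
      fix l assume l: "q \<le> l \<and> l < int (Suc n + p)"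
      then consider "l < int (n + p)" | "l = int (n + p)" by linarith
      then show "Y l = Z l" using Suc eq l by cases auto
    qed
  qed
  from this[of "nat (k + 1)"] show ?thesis using \<open>q \<le> k\<close> by simp
qed

lemma sum_int_last:
  fixes f :: "int \<Rightarrow> 'a::comm_monoid_add"
  assumes "a \<le> b"
  shows "sum f {a..b} = sum f {a..<b} + f b"
proof -
  have "{a..b} = insert b {a..<b}" using assms by auto
  then show ?thesis by (simp add: add.commute)
qed

lemma invertible_matrix_inv:
  assumes "invertible (M :: 'n::finite cmat)"
  shows "M ** matrix_inv M = mat 1" "matrix_inv M ** M = mat 1"
  using someI_ex[OF assms[unfolded invertible_def]] by (simp_all add: matrix_inv_def)

lemma right_step:
  assumes "band_matrix r s A" "k = int n"
  shows "(\<Sum>l = k - int s..k + int r. ext_entry r s A k l ** Y l) = mscale lam (Y k) \<longleftrightarrow>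
    Y (int (n + r)) = matrix_inv (A n (n + r)) **
      (mscale lam (Y k) - (\<Sum>l = k - int s..<k + int r. ext_entry r s A k l ** Y l))"
proof -
  let ?M = "A n (n + r)" and ?S = "\<Sum>l = k - int s..<k + int r. ext_entry r s A k l ** Y l"
  have inv: "?M ** matrix_inv ?M = mat 1" "matrix_inv ?M ** ?M = mat 1"
    using assms invertible_matrix_inv unfolding band_matrix_def by blast+
  have last: "ext_entry r s A k (k + int r) = ?M"
    by (simp add: ext_entry_def assms(2) nat_add_distrib)
  have "(\<Sum>l = k - int s..k + int r. ext_entry r s A k l ** Y l) = ?S + ?M ** Y (int (n + r))"
    by (subst sum_int_last) (simp_all only: last, simp_all add: assms(2))
  moreover have "?S + ?M ** X = Z \<longleftrightarrow> X = matrix_inv ?M ** (Z - ?S)" for X Z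
  proof
    assume "?S + ?M ** X = Z"
    then have "Z - ?S = ?M ** X" by auto
    then show "X = matrix_inv ?M ** (Z - ?S)"
      by (simp only: matrix_mul_assoc inv matrix_mul_lid)
  next
    assume X: "X = matrix_inv ?M ** (Z - ?S)"
    have "?M ** X = Z - ?S" unfolding X by (simp only: matrix_mul_assoc inv matrix_mul_lid)
    then show "?S + ?M ** X = Z" by simp
  qed
  ultimately show ?thesis by (simp only:)
qed

lemma left_step:
  assumes "band_matrix r s A" "k = int n"
  shows "(\<Sum>l = k - int r..k + int s. Y l ** ext_entry r s A l k) = mscale lam (Y k) \<longleftrightarrow>
    Y (int (n + s)) =
      (mscale lam (Y k) - (\<Sum>l = k - int r..<k + int s. Y l ** ext_entry r s A l k)) **
      matrix_inv (A (n + s) n)"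
proof -
  let ?M = "A (n + s) n" and ?S = "\<Sum>l = k - int r..<k + int s. Y l ** ext_entry r s A l k"
  have inv: "?M ** matrix_inv ?M = mat 1" "matrix_inv ?M ** ?M = mat 1"
    using assms invertible_matrix_inv unfolding band_matrix_def by blast+
  have last: "ext_entry r s A (k + int s) k = ?M"
    by (simp add: ext_entry_def assms(2) nat_add_distrib)
  have "(\<Sum>l = k - int r..k + int s. Y l ** ext_entry r s A l k) = ?S + Y (int (n + s)) ** ?M"
    by (subst sum_int_last) (simp_all only: last, simp_all add: assms(2))
  moreover have "?S + X ** ?M = Z \<longleftrightarrow> X = (Z - ?S) ** matrix_inv ?M" for X Z
  proof
    assume "?S + X ** ?M = Z"
    then have "Z - ?S = X ** ?M" by auto
    then show "X = (Z - ?S) ** matrix_inv ?M"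
      by (simp only: matrix_mul_assoc[symmetric] inv matrix_mul_rid)
  next
    assume X: "X = (Z - ?S) ** matrix_inv ?M"
    have "X ** ?M = Z - ?S" unfolding X by (simp only: matrix_mul_assoc[symmetric] inv matrix_mul_rid)
    then show "?S + X ** ?M = Z" by simp
  qed
  ultimately show ?thesis by (simp only:)
qed

lemma right_solution_exists:
  assumes "band_matrix r s A" "r > 0"
  shows "\<exists>Y. right_solution r s A lam Y \<and> (\<forall>k < int r. Y k = init k)"
proof -
  define G where "G n Y = matrix_inv (A n (n + r)) ** (mscale lam (Y (int n)) -
      (\<Sum>l = int n - int s..<int n + int r. ext_entry r s A (int n) l ** Y l))" for n Y
  have "G n f = G n g" if eq: "\<And>l. l < int (n + r) \<Longrightarrow> f l = g l" for n f g
  proof -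
    have "(\<Sum>l = int n - int s..<int n + int r. ext_entry r s A (int n) l ** f l) =
        (\<Sum>l = int n - int s..<int n + int r. ext_entry r s A (int n) l ** g l)"
      by (rule sum.cong) (auto simp: eq)
    moreover have "f (int n) = g (int n)" using eq \<open>r > 0\<close> by simp
    ultimately show ?thesis by (simp only: G_def)
  qed
  from forward_recursion_exists[of r G init, OF this] obtain Y where
    Y: "\<forall>k < int r. Y k = init k" "\<And>n. Y (int (n + r)) = G n Y" by blast
  have "right_solution r s A lam Y"
    unfolding right_solution_def
  proof (intro allI impI)
    fix k :: int assume "0 \<le> k"
    then have k: "k = int (nat k)" by simp
    show "(\<Sum>l = k - int s..k + int r. ext_entry r s A k l ** Y l) = mscale lam (Y k)"
      unfolding right_step[OF assms(1) k] using Y(2)[of "nat k"] k by (simp add: G_def)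
  qed
  with Y(1) show ?thesis by blast
qed

lemma left_solution_exists:
  assumes "band_matrix r s A" "s > 0"
  shows "\<exists>Y. left_solution r s A lam Y \<and> (\<forall>k < int s. Y k = init k)"
proof -
  define G where "G n Y = (mscale lam (Y (int n)) -
      (\<Sum>l = int n - int r..<int n + int s. Y l ** ext_entry r s A l (int n))) **
      matrix_inv (A (n + s) n)" for n Y
  have "G n f = G n g" if eq: "\<And>l. l < int (n + s) \<Longrightarrow> f l = g l" for n f g
  proof -
    have "(\<Sum>l = int n - int r..<int n + int s. f l ** ext_entry r s A l (int n)) =
        (\<Sum>l = int n - int r..<int n + int s. g l ** ext_entry r s A l (int n))"
      by (rule sum.cong) (auto simp: eq)
    moreover have "f (int n) = g (int n)" using eq \<open>s > 0\<close> by simp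
    ultimately show ?thesis by (simp only: G_def)
  qed
  from forward_recursion_exists[of s G init, OF this] obtain Y where
    Y: "\<forall>k < int s. Y k = init k" "\<And>n. Y (int (n + s)) = G n Y" by blast
  have "left_solution r s A lam Y"
    unfolding left_solution_def
  proof (intro allI impI)
    fix k :: int assume "0 \<le> k"
    then have k: "k = int (nat k)" by simp
    show "(\<Sum>l = k - int r..k + int s. Y l ** ext_entry r s A l k) = mscale lam (Y k)"
      unfolding left_step[OF assms(1) k] using Y(2)[of "nat k"] k by (simp add: G_def)
  qed
  with Y(1) show ?thesis by blast
qed

lemma right_fundamental_exists:
  assumes "band_matrix r s A" "r > 0"
  shows "\<exists>Q. right_fundamental r s A Q"
proof -
  have "\<forall>i lam. \<exists>Y. right_solution r s A lam Y \<and>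
      (\<forall>k < int r. Y k = (if k + 1 = int i then mat 1 else 0))"
    by (intro allI right_solution_exists[OF assms])
  then obtain Q where Q: "\<And>i lam. right_solution r s A lam (Q i lam)"
    "\<And>i lam k. k < int r \<Longrightarrow> Q i lam k = (if k + 1 = int i then mat 1 else 0)" by metis
  have "right_fundamental r s A Q"
    unfolding right_fundamental_def using Q by auto
  then show ?thesis by blast
qed

lemma left_fundamental_exists:
  assumes "band_matrix r s A" "s > 0"
  shows "\<exists>Qp. left_fundamental r s A Qp"
proof -
  have "\<forall>j lam. \<exists>Y. left_solution r s A lam Y \<and>
      (\<forall>k < int s. Y k = (if k + 1 = int j then mat 1 else 0))"
    by (intro allI left_solution_exists[OF assms])
  then obtain Q where Q: "\<And>j lam. left_solution r s A lam (Q j lam)"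
    "\<And>j lam k. k < int s \<Longrightarrow> Q j lam k = (if k + 1 = int j then mat 1 else 0)" by metis
  have "left_fundamental r s A Q"
    unfolding left_fundamental_def using Q by auto
  then show ?thesis by blast
qed

lemma right_fundamental_unique:
  assumes A: "band_matrix r s A" "r > 0"
    and Q: "right_fundamental r s A Q" "right_fundamental r s A Q'"
    and "i \<in> {1..r}" "k \<ge> - int s"
  shows "Q i lam k = Q' i lam k"
proof (rule forward_recursion_unique[where q = "- int s" and p = r])
  fix k assume k: "- int s \<le> k" "k < int r"
  show "Q i lam k = Q' i lam k"
  proof (cases "k < 0")
    case True
    then have "k \<in> {- int s..-1}" using k by auto
    then show ?thesis using Q \<open>i \<in> _\<close> unfolding right_fundamental_def by metis
  next
    case False
    then obtain m where "k = int m" "m < r" using k by (metis int_eq_iff linorder_not_less of_nat_less_iff)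
    then show ?thesis using Q \<open>i \<in> _\<close> unfolding right_fundamental_def by metis
  qed
next
  fix n assume eq: "\<And>l. - int s \<le> l \<Longrightarrow> l < int (n + r) \<Longrightarrow> Q i lam l = Q' i lam l"
  have sol: "right_solution r s A lam (Q i lam)" "right_solution r s A lam (Q' i lam)"
    using Q \<open>i \<in> _\<close> unfolding right_fundamental_def by blast+
  have "(\<Sum>l = int n - int s..<int n + int r. ext_entry r s A (int n) l ** Q i lam l) =
      (\<Sum>l = int n - int s..<int n + int r. ext_entry r s A (int n) l ** Q' i lam l)"
    by (rule sum.cong) (auto simp: eq)
  moreover have "Q i lam (int n) = Q' i lam (int n)" using eq \<open>r > 0\<close> by simp
  ultimately show "Q i lam (int (n + r)) = Q' i lam (int (n + r))"
    using sol[unfolded right_solution_def, rule_format, of "int n",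
        unfolded right_step[OF A(1) refl]] by simp
qed (use assms in auto)

lemma left_fundamental_unique:
  assumes A: "band_matrix r s A" "s > 0"
    and Q: "left_fundamental r s A Q" "left_fundamental r s A Q'"
    and "j \<in> {1..s}" "k \<ge> - int r"
  shows "Q j lam k = Q' j lam k"
proof (rule forward_recursion_unique[where q = "- int r" and p = s])
  fix k assume k: "- int r \<le> k" "k < int s"
  show "Q j lam k = Q' j lam k"
  proof (cases "k < 0")
    case True
    then have "k \<in> {- int r..-1}" using k by auto
    then show ?thesis using Q \<open>j \<in> _\<close> unfolding left_fundamental_def by metis
  next
    case False
    then obtain m where "k = int m" "m < s" using k by (metis int_eq_iff linorder_not_less of_nat_less_iff)
    then show ?thesis using Q \<open>j \<in> _\<close> unfolding left_fundamental_def by metis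
  qed
next
  fix n assume eq: "\<And>l. - int r \<le> l \<Longrightarrow> l < int (n + s) \<Longrightarrow> Q j lam l = Q' j lam l"
  have sol: "left_solution r s A lam (Q j lam)" "left_solution r s A lam (Q' j lam)"
    using Q \<open>j \<in> _\<close> unfolding left_fundamental_def by blast+
  have "(\<Sum>l = int n - int r..<int n + int s. Q j lam l ** ext_entry r s A l (int n)) =
      (\<Sum>l = int n - int r..<int n + int s. Q' j lam l ** ext_entry r s A l (int n))"
    by (rule sum.cong) (auto simp: eq)
  moreover have "Q j lam (int n) = Q' j lam (int n)" using eq \<open>s > 0\<close> by simp
  ultimately show "Q j lam (int (n + s)) = Q' j lam (int (n + s))"
    using sol[unfolded left_solution_def, rule_format, of "int n",
        unfolded left_step[OF A(1) refl]] by simp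
qed (use assms in auto)

end

theory Submission
  imports Defs
begin

text \<open>
  A solution \<open>Y\<close> of the right difference equation that vanishes at the negative indices
  satisfies \<open>(\<lambda> - A) Y = 0\<close> row by row, so for a vector \<open>v\<close> the sequence \<open>u\<^sub>k = Y\<^sub>k v\<close> is a formal
  null vector of \<open>\<lambda> - A\<close>. Put \<open>m = r + s\<close> and cut \<open>u\<close> off at some index \<open>M\<close>. Because \<open>A\<close> is banded,
  applying \<open>\<lambda> - A\<close> to the truncated sequence gives zero except in the \<open>2m\<close> rows around \<open>M\<close>,
  and these rows involve only the last \<open>2m\<close> entries kept. On the other hand \<open>\<lambda>\<close> lies in the
  resolvent set, so \<open>\<lambda> - A\<close> is bounded below on finitely supported sequences. Hence the
  squared norm \<open>S\<^sub>M\<close> of the truncation is at most a constant times \<open>S\<^sub>M - S\<^bsub>M-2m\<^esub>\<close>, which means that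
  \<open>S\<close> gains a fixed factor greater than one in every \<open>2m\<close> steps
  (\<open>kernel_partial_sums_grow\<close>). Partial sums of squares that grow geometrically force the
  upper limit of the \<open>k\<close>-th roots above one (\<open>limsup_root_gt_1_if_partial_sums_grow\<close>). The
  matrix norm enters through \<open>\<bar>X v\<bar> \<le> c \<parallel>X\<parallel> \<bar>v\<bar>\<close>, applied to the blocks of \<open>A\<close> and to the \<open>Y\<^sub>k\<close>.

  Transposition turns the left equation for \<open>A\<close> into the right equation for the matrix with
  blocks \<open>(A\<^sub>l\<^sub>k)\<close> transposed, with \<open>r\<close> and \<open>s\<close> exchanged. Only the lower bound needs a
  separate argument there: for \<open>A\<close> it comes from the resolvent as a left inverse
  (\<open>resolvent_bounded_below\<close>), for the transposed matrix from the resolvent as a right inverse,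
  by duality (\<open>resolvent_transpose_bounded_below\<close>).
\<close>

section \<open>Geometric growth of partial sums and the root test\<close>

text \<open>
  If the upper limit were at most one, then \<open>\<Sum> a\<^sub>k\<^sup>2 x\<^sup>k\<close> would converge for every \<open>x\<close> in \<open>(0, 1)\<close>, and its
  value would bound every \<open>S\<^sub>M x\<^sup>M\<close>, where \<open>S\<^sub>M\<close> is the partial sum of the squares. But \<open>S\<^sub>M x\<^sup>M\<close> is
  unbounded once \<open>\<rho> x\<^sup>p > 1\<close>, because \<open>S\<close> is eventually positive and every \<open>p\<close> steps multiply
  it by at least \<open>\<rho>\<close>.
\<close>

lemma limsup_root_gt_1_if_partial_sums_grow:
  fixes a b :: "nat \<Rightarrow> real"
  assumes "\<rho> > 1" "p > 0"
    and growth: "\<And>M. \<rho> * (\<Sum>k<M. (a k)\<^sup>2) \<le> (\<Sum>k<M + p. (a k)\<^sup>2)"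
    and "a k0 \<noteq> 0"
    and dominated: "\<And>k. \<bar>a k\<bar> \<le> c * b k" and b_nonneg: "\<And>k. b k \<ge> 0"
  shows "limsup (\<lambda>k. ereal (root k (b k))) > 1"
proof (rule ccontr)
  \<comment> \<open>The exponent leaves room on both sides: \<open>a\<^sub>k\<^sup>2 = O(\<eta>\<^bsup>2k\<^esup>)\<close> is summable against \<open>x\<^sup>k = \<eta>\<^bsup>-3k\<^esup>\<close>,
    while \<open>\<rho> x\<^sup>p = \<eta>\<^bsup>6p-3p\<^esup>\<close> still exceeds one.\<close>
  define \<eta> where "\<eta> = root (6 * p) \<rho>"
  define x where "x = 1 / \<eta> ^ 3"
  define S where "S M = (\<Sum>k<M. (a k)\<^sup>2)" for M
  have \<eta>: "\<eta> > 1" and \<eta>_pow: "\<eta> ^ (6 * p) = \<rho>"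
    using assms by (simp_all add: \<eta>_def)
  have x: "0 < x" "x < 1"
    using \<eta> by (simp_all add: x_def)
  assume "\<not> limsup (\<lambda>k. ereal (root k (b k))) > 1"
  then have "limsup (\<lambda>k. ereal (root k (b k))) \<le> 1" by (simp only: not_less)
  also have "(1::ereal) < ereal \<eta>" using \<eta> by simp
  finally have "limsup (\<lambda>k. ereal (root k (b k))) < ereal \<eta>" .
  then have "eventually (\<lambda>k. ereal (root k (b k)) < ereal \<eta>) sequentially"
    by (rule Limsup_lessD)
  then have "eventually (\<lambda>k. norm ((a k)\<^sup>2 * x ^ k) \<le> c\<^sup>2 * (1 / \<eta>) ^ k) sequentially"
    using eventually_gt_at_top[of 0]
  proof eventually_elim
    case (elim k)
    have "b k = root k (b k) ^ k" using elim b_nonneg by simp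
    also have "\<dots> \<le> \<eta> ^ k" using elim b_nonneg by (intro power_mono) simp_all
    finally have "(b k)\<^sup>2 \<le> (\<eta> ^ k)\<^sup>2" using b_nonneg by (intro power_mono) simp_all
    moreover have "(a k)\<^sup>2 \<le> c\<^sup>2 * (b k)\<^sup>2"
      using power_mono[OF dominated[of k], of 2] by (simp add: power_mult_distrib)
    ultimately have "(a k)\<^sup>2 \<le> c\<^sup>2 * (\<eta> ^ k)\<^sup>2"
      by (meson mult_left_mono order_trans zero_le_power2)
    then have "(a k)\<^sup>2 * x ^ k \<le> c\<^sup>2 * (\<eta> ^ k)\<^sup>2 * x ^ k"
      using x by (intro mult_right_mono) simp_all
    also have "\<dots> = c\<^sup>2 * (1 / \<eta>) ^ k"
      using \<eta> by (simp add: x_def power_divide field_simps flip: power_mult power_add)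
    finally show ?case using x by simp
  qed
  moreover have "summable (\<lambda>k. c\<^sup>2 * (1 / \<eta>) ^ k)"
    using \<eta> by (intro summable_mult summable_geometric) simp
  ultimately have summable: "summable (\<lambda>k. (a k)\<^sup>2 * x ^ k)"
    by (rule summable_comparison_test_ev)
  define W where "W = (\<Sum>k. (a k)\<^sup>2 * x ^ k)"
  have upper: "S M * x ^ M \<le> W" for M
  proof -
    have "S M * x ^ M = (\<Sum>k<M. (a k)\<^sup>2 * x ^ M)" by (simp add: S_def sum_distrib_right)
    also have "\<dots> \<le> (\<Sum>k<M. (a k)\<^sup>2 * x ^ k)"
      using x by (intro sum_mono mult_left_mono power_decreasing) simp_all
    also have "\<dots> \<le> W"
      unfolding W_def using x by (intro sum_le_suminf summable) simp_all
    finally show ?thesis .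
  qed
  have lower: "\<rho> ^ n * S M \<le> S (M + n * p)" for n M
  proof (induction n)
    case (Suc n)
    have "\<rho> ^ Suc n * S M \<le> \<rho> * S (M + n * p)" using Suc \<open>\<rho> > 1\<close> by simp
    also have "\<dots> \<le> S (M + n * p + p)" unfolding S_def by (rule growth)
    finally show ?case by (simp add: algebra_simps)
  qed simp
  define S0 where "S0 = S (Suc k0) * x ^ Suc k0"
  have "S (Suc k0) > 0"
    unfolding S_def using \<open>a k0 \<noteq> 0\<close> by (intro sum_pos2[where i = k0]) simp_all
  then have S0: "S0 > 0" using x by (simp add: S0_def)
  have gain: "\<rho> * x ^ p = \<eta> ^ (3 * p)"
    using \<eta> by (simp add: x_def power_divide flip: \<eta>_pow power_mult power_add)
      (simp add: field_simps flip: power_add)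
  have "\<eta> ^ (3 * p) > 1" using \<eta> \<open>p > 0\<close> by simp
  then obtain n where n: "W / S0 < (\<eta> ^ (3 * p)) ^ n" using real_arch_pow by blast
  have "(\<eta> ^ (3 * p)) ^ n * S0 = \<rho> ^ n * S (Suc k0) * x ^ (Suc k0 + n * p)"
    unfolding gain[symmetric] S0_def power_mult_distrib power_add mult.commute[of n p]
      power_mult[of x p n] by (simp only: mult_ac)
  also have "\<dots> \<le> S (Suc k0 + n * p) * x ^ (Suc k0 + n * p)"
    using x by (intro mult_right_mono lower) simp_all
  also have "\<dots> \<le> W" by (rule upper)
  finally show False using n S0 by (simp add: field_simps)
qed

section \<open>Kernel vectors of a banded operator that is bounded below\<close>

text \<open>
  This is the estimate \<open>\<parallel>w\<parallel>\<^sup>2 \<le> C \<parallel>T w\<parallel>\<^sup>2\<close> for finitely supported \<open>w\<close>, where \<open>T\<close> is a matrix of maps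
  of bandwidth \<open>m\<close>. It is phrased for truncations of arbitrary sequences, and the image of a
  truncation at \<open>M\<close> lives below \<open>M + m\<close>, so that both sides are finite sums.
\<close>

definition bounded_below_on_truncations ::
    "nat \<Rightarrow> (nat \<Rightarrow> nat \<Rightarrow> 'a::real_normed_vector \<Rightarrow> 'b::real_normed_vector) \<Rightarrow> real \<Rightarrow> bool" where
  "bounded_below_on_truncations m T C \<longleftrightarrow>
     (\<forall>u M. (\<Sum>k<M. (norm (u k))\<^sup>2) \<le> C * (\<Sum>k<M + m. (norm (\<Sum>l<M. T k l (u l)))\<^sup>2))"

text \<open>
  For \<open>M' = M + 2m\<close> the truncation of \<open>u\<close> at \<open>M'\<close> has a residual that vanishes in the rows
  \<open>k < M + m\<close>, since these see nothing of the cut, and that is controlled in the remaining \<open>2m\<close> rows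
  by the entries in \<open>J\<close>, the last \<open>2m\<close> before the cut. The lower bound turns this
  into \<open>S\<^bsub>M'\<^esub> \<le> K (S\<^bsub>M'\<^esub> - S\<^sub>M)\<close>, that is \<open>S\<^sub>M \<le> (1 - 1/K) S\<^bsub>M'\<^esub>\<close>.
\<close>

lemma kernel_partial_sums_grow:
  fixes T :: "nat \<Rightarrow> nat \<Rightarrow> 'a::real_normed_vector \<Rightarrow> 'b::real_normed_vector"
  assumes band: "\<And>k l v. k + m < l \<or> l + m < k \<Longrightarrow> T k l v = 0"
    and bound: "\<And>k l v. norm (T k l v) \<le> \<beta> * norm v"
    and kernel: "\<And>k. (\<Sum>l<Suc (k + m). T k l (u l)) = 0"
    and below: "bounded_below_on_truncations m T C"
  shows "\<exists>\<rho>>1. \<forall>M. \<rho> * (\<Sum>k<M. (norm (u k))\<^sup>2) \<le> (\<Sum>k<M + 2 * m. (norm (u k))\<^sup>2)"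
proof -
  \<comment> \<open>The summand 2 only ensures \<open>K > 1\<close>, so that \<open>K / (K - 1)\<close> is a genuine growth factor.\<close>
  define K where "K = \<bar>C\<bar> * (\<beta>\<^sup>2 * (2 * m) * (2 * m)) + 2"
  define S where "S M = (\<Sum>k<M. (norm (u k))\<^sup>2)" for M
  have K: "K \<ge> 2" by (simp add: K_def)
  have step: "K * S M \<le> (K - 1) * S (M + 2 * m)" for M
  proof -
    define J where "J = {M..<M + 2 * m}"
    define f where "f k = (\<Sum>l<M + 2 * m. T k l (u l))" for k
    have S_J: "S (M + 2 * m) - S M = (\<Sum>l\<in>J. (norm (u l))\<^sup>2)"
      using sum.atLeastLessThan_concat[of 0 M "M + 2 * m" "\<lambda>l. (norm (u l))\<^sup>2"]
      by (simp add: S_def J_def lessThan_atLeast0)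
    have S_J_nonneg: "0 \<le> S (M + 2 * m) - S M"
      unfolding S_J by (intro sum_nonneg) simp
    have f_0: "f k = 0" if "k < M + m" for k
    proof -
      have "f k = (\<Sum>l<Suc (k + m). T k l (u l))"
        unfolding f_def using that by (intro sum.mono_neutral_right) (auto intro: band)
      then show ?thesis by (simp only: kernel)
    qed
    have f_le: "(norm (f k))\<^sup>2 \<le> \<beta>\<^sup>2 * (2 * m) * (S (M + 2 * m) - S M)" if "M + m \<le> k" for k
    proof -
      have "f k = (\<Sum>l\<in>J. T k l (u l))"
        unfolding f_def J_def using that by (intro sum.mono_neutral_right) (auto intro: band)
      then have "norm (f k) \<le> (\<Sum>l\<in>J. \<beta> * norm (u l))"
        by (auto intro!: sum_norm_le bound)
      then have "(norm (f k))\<^sup>2 \<le> (\<Sum>l\<in>J. \<beta> * norm (u l))\<^sup>2" by (intro power_mono) simp_all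
      also have "\<dots> \<le> (\<Sum>l\<in>J. (\<beta> * norm (u l))\<^sup>2) * card J"
        by (rule sum_squared_le_sum_of_squares)
      also have "\<dots> = \<beta>\<^sup>2 * (2 * m) * (S (M + 2 * m) - S M)"
        by (simp add: S_J power_mult_distrib flip: sum_distrib_left) (simp add: J_def)
      finally show ?thesis .
    qed
    have "(\<Sum>k<M + 2 * m + m. (norm (f k))\<^sup>2) = (\<Sum>k\<in>{M + m..<M + m + 2 * m}. (norm (f k))\<^sup>2)"
      by (intro sum.mono_neutral_right) (auto simp: f_0)
    also have "\<dots> \<le> (\<Sum>k\<in>{M + m..<M + m + 2 * m}. \<beta>\<^sup>2 * (2 * m) * (S (M + 2 * m) - S M))"
      by (intro sum_mono f_le) simp
    also have "\<dots> = \<beta>\<^sup>2 * (2 * m) * (2 * m) * (S (M + 2 * m) - S M)" by simp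
    finally have residual: "(\<Sum>k<M + 2 * m + m. (norm (f k))\<^sup>2)
        \<le> \<beta>\<^sup>2 * (2 * m) * (2 * m) * (S (M + 2 * m) - S M)" .
    have "S (M + 2 * m) \<le> C * (\<Sum>k<M + 2 * m + m. (norm (f k))\<^sup>2)"
      using below unfolding bounded_below_on_truncations_def S_def f_def by blast
    also have "\<dots> \<le> \<bar>C\<bar> * (\<Sum>k<M + 2 * m + m. (norm (f k))\<^sup>2)"
      by (intro mult_right_mono sum_nonneg) simp_all
    also have "\<dots> \<le> \<bar>C\<bar> * (\<beta>\<^sup>2 * (2 * m) * (2 * m) * (S (M + 2 * m) - S M))"
      by (intro mult_left_mono residual) simp
    also have "\<dots> = (K - 2) * (S (M + 2 * m) - S M)" by (simp add: K_def)
    also have "\<dots> \<le> K * (S (M + 2 * m) - S M)"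
      using S_J_nonneg by (intro mult_right_mono) simp_all
    finally show ?thesis by (simp add: algebra_simps)
  qed
  have "K / (K - 1) > 1" using K by simp
  moreover have "K / (K - 1) * S M \<le> S (M + 2 * m)" for M
    using step[of M] K by (simp add: field_simps)
  ultimately show ?thesis unfolding S_def by blast
qed

section \<open>Matrix norms\<close>

lemma mscale_of_real: "mscale (of_real c) X = c *\<^sub>R X"
  unfolding vec_eq_iff mscale_def by (simp add: scaleR_conv_of_real[where 'a = complex])

text \<open>
  A norm on a finite-dimensional space is convex, hence continuous, so it attains a minimum on
  the compact unit sphere, and this minimum is positive.
\<close>

lemma matrix_norm_dominates_norm:
  fixes nrm :: "'n::finite cmat \<Rightarrow> real"
  assumes "matrix_norm nrm"
  shows "\<exists>c>0. \<forall>X. norm X \<le> c * nrm X"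
proof -
  have nonneg: "nrm X \<ge> 0" and zero_iff: "nrm X = 0 \<longleftrightarrow> X = 0"
    and triangle: "nrm (X + Y) \<le> nrm X + nrm Y"
    and "nrm (mscale z X) = cmod z * nrm X" for X Y z
    using assms by (simp_all add: matrix_norm_def)
  from this(4)[of "of_real _"] have scale: "nrm (c *\<^sub>R X) = \<bar>c\<bar> * nrm X" for c X
    by (simp add: mscale_of_real)
  have "convex_on UNIV nrm"
  proof (rule convex_onI)
    fix t :: real and X Y assume "0 < t" "t < 1"
    then show "nrm ((1 - t) *\<^sub>R X + t *\<^sub>R Y) \<le> (1 - t) * nrm X + t * nrm Y"
      using triangle[of "(1 - t) *\<^sub>R X" "t *\<^sub>R Y"] by (simp add: scale)
  qed simp
  then have cont: "continuous_on (sphere 0 1) nrm"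
    using convex_on_continuous[OF open_UNIV] continuous_on_subset by blast
  have "compact (sphere (0 :: 'n cmat) 1)" "sphere (0 :: 'n cmat) 1 \<noteq> {}"
    by (auto simp del: sphere_empty)
  from continuous_attains_inf[OF this cont] obtain X0
    where X0: "X0 \<in> sphere 0 1" and le: "\<And>X. X \<in> sphere 0 1 \<Longrightarrow> nrm X0 \<le> nrm X" by blast
  have "X0 \<noteq> 0" using X0 by auto
  then have pos: "nrm X0 > 0" using nonneg[of X0] zero_iff[of X0] by linarith
  have "norm X \<le> 1 / nrm X0 * nrm X" for X
  proof (cases "X = 0")
    case False
    then have "nrm X0 \<le> nrm ((1 / norm X) *\<^sub>R X)" by (intro le) simp
    then show ?thesis using pos False by (simp add: scale field_simps)
  qed (simp add: nonneg)
  then show ?thesis using pos by (intro exI[of _ "1 / nrm X0"]) simp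
qed

lemma matrix_norm_dominates_action:
  fixes nrm :: "'n::finite cmat \<Rightarrow> real"
  assumes "matrix_norm nrm"
  shows "\<exists>c>0. \<forall>X v. norm (X *v v) \<le> c * nrm X * norm v"
proof -
  obtain c where c: "c > 0" "\<And>X. norm X \<le> c * nrm X"
    using matrix_norm_dominates_norm[OF assms] by blast
  have "bilinear ((*v) :: 'n cmat \<Rightarrow> _)"
    unfolding bilinear_def
    by (intro conjI allI linearI)
       (simp_all add: matrix_vector_mult_def vec_eq_iff sum.distrib algebra_simps scaleR_sum_right)
  then have "bounded_bilinear ((*v) :: 'n cmat \<Rightarrow> _)"
    by (simp add: bilinear_conv_bounded_bilinear)
  then obtain K where K: "K > 0" "\<And>X v. norm ((X :: 'n cmat) *v v) \<le> norm X * norm v * K"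
    using bounded_bilinear.pos_bounded by blast
  have "norm (X *v v) \<le> c * K * nrm X * norm v" for X v
  proof -
    have "norm (X *v v) \<le> norm X * (norm v * K)" using K(2)[of X v] by (simp add: mult.assoc)
    also have "\<dots> \<le> c * nrm X * (norm v * K)"
      using K(1) by (intro mult_right_mono c) simp
    finally show ?thesis by (simp add: algebra_simps)
  qed
  then show ?thesis using c(1) K(1) by (intro exI[of _ "c * K"]) simp
qed

lemma transpose_0: "transpose (0 :: 'n::finite cmat) = 0"
  by (simp add: transpose_def vec_eq_iff)

lemma transpose_uminus: "transpose (- X) = - transpose X" for X :: "'n::finite cmat"
  by (simp add: transpose_def vec_eq_iff)

lemma transpose_add: "transpose (X + Z) = transpose X + transpose Z" for X Z :: "'n::finite cmat"
  by (simp add: transpose_def vec_eq_iff)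

lemma transpose_mscale: "transpose (mscale c X) = mscale c (transpose X)"
  by (simp add: transpose_def vec_eq_iff mscale_def)

lemma transpose_sum:
  fixes X :: "'a \<Rightarrow> 'n::finite cmat"
  shows "transpose (\<Sum>l\<in>I. X l) = (\<Sum>l\<in>I. transpose (X l))"
  by (induction I rule: infinite_finite_induct) (simp_all add: transpose_0 transpose_add)

lemma matrix_norm_transpose:
  fixes nrm :: "'n::finite cmat \<Rightarrow> real"
  assumes "matrix_norm nrm"
  shows "matrix_norm (\<lambda>X. nrm (transpose X))"
proof -
  have "transpose X = 0 \<longleftrightarrow> X = 0" for X :: "'n cmat"
    by (metis transpose_0 transpose_transpose)
  then show ?thesis using assms by (simp add: matrix_norm_def transpose_add transpose_mscale)
qed

section \<open>Solutions of the difference equations as kernel vectors\<close>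

definition shifted_entry ::
    "complex \<Rightarrow> (nat \<Rightarrow> nat \<Rightarrow> 'n::finite cmat) \<Rightarrow> nat \<Rightarrow> nat \<Rightarrow> complex^'n \<Rightarrow> complex^'n" where
  "shifted_entry lam A k l v = (if k = l then lam *s v else 0) - A k l *v v"

lemma shifted_entry_band:
  assumes "band_matrix r s A" "k + (r + s) < l \<or> l + (r + s) < k"
  shows "shifted_entry lam A k l v = 0"
  using assms by (auto simp: shifted_entry_def band_matrix_def)

lemma sum_matrix_vector_mult_left:
  "finite I \<Longrightarrow> (\<Sum>i\<in>I. X i) *v v = (\<Sum>i\<in>I. X i *v v)"
  by (induction I rule: finite_induct) (simp_all add: matrix_vector_mult_add_rdistrib)

text \<open>
  The initial zeros at \<open>-s, \<dots>, -1\<close> remove the terms with negative index from the difference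
  equation, so that only entries of \<open>A\<close> itself remain; the entries added
  to the range \<open>l \<le> k + r + s\<close> lie off the band.
\<close>

lemma right_solution_kernel:
  assumes band: "band_matrix r s A" and sol: "right_solution r s A lam Y"
    and init: "\<forall>k\<in>{- int s..-1}. Y k = 0"
  shows "(\<Sum>l<Suc (k + (r + s)). shifted_entry lam A k l (Y (int l) *v v)) = 0"
proof -
  let ?L = "{..<Suc (k + (r + s))}"
  have "lam *s (Y (int k) *v v) = mscale lam (Y (int k)) *v v"
    by (simp add: mscale_def matrix_vector_mult_def vec_eq_iff sum_distrib_left mult.assoc)
  also have "mscale lam (Y (int k)) = (\<Sum>l = int k - int s..int k + int r. ext_entry r s A (int k) l ** Y l)"
    using sol by (simp add: right_solution_def)
  also have "\<dots> = (\<Sum>l\<in>int ` ?L. ext_entry r s A (int k) l ** Y l)"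
  proof (rule sum.mono_neutral_cong)
    fix l assume l: "l \<in> {int k - int s..int k + int r} - int ` ?L"
    have "l < 0"
    proof (rule ccontr)
      assume "\<not> l < 0"
      then have "l = int (nat l)" "nat l < Suc (k + (r + s))" using l by auto
      then have "l \<in> int ` ?L" by blast
      then show False using l by blast
    qed
    then have "Y l = 0" using l init by auto
    then show "ext_entry r s A (int k) l ** Y l = 0" by simp
  next
    fix l assume "l \<in> int ` ?L - {int k - int s..int k + int r}"
    then obtain j where "l = int j" "j + s < k \<or> k + r < j" by auto
    then have "ext_entry r s A (int k) l = 0"
      using band by (auto simp: ext_entry_def band_matrix_def)
    then show "ext_entry r s A (int k) l ** Y l = 0" by simp
  qed simp_all
  also have "\<dots> = (\<Sum>l\<in>?L. A k l ** Y (int l))"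
    by (subst sum.reindex) (simp_all add: ext_entry_def)
  also have "\<dots> *v v = (\<Sum>l\<in>?L. A k l *v (Y (int l) *v v))"
    by (simp add: sum_matrix_vector_mult_left matrix_vector_mul_assoc del: sum.lessThan_Suc)
  finally have "(\<Sum>l\<in>?L. A k l *v (Y (int l) *v v)) = lam *s (Y (int k) *v v)" by simp
  moreover have "(\<Sum>l\<in>?L. if k = l then lam *s (Y (int l) *v v) else 0) = lam *s (Y (int k) *v v)"
    by (simp add: sum.delta' del: sum.lessThan_Suc)
  ultimately show ?thesis
    by (simp add: shifted_entry_def sum_subtractf del: sum.lessThan_Suc)
qed

lemma limsup_root_right_solution_gt_1:
  fixes nrm :: "'n::finite cmat \<Rightarrow> real"
  assumes "r + s > 0" and nrm: "matrix_norm nrm" and band: "band_matrix r s A"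
    and bdd: "bdd_above (range (\<lambda>(i, j). nrm (A i j)))"
    and sol: "right_solution r s A lam Y" "\<forall>k\<in>{- int s..-1}. Y k = 0"
    and "Y (int k0) \<noteq> 0"
    and below: "bounded_below_on_truncations (r + s) (shifted_entry lam A) C"
  shows "limsup (\<lambda>k. ereal (root k (nrm (Y (int k))))) > 1"
proof -
  obtain c where c: "c > 0" "\<And>X v. norm (X *v v) \<le> c * nrm X * norm v"
    using matrix_norm_dominates_action[OF nrm] by blast
  obtain b where b: "\<And>i j. nrm (A i j) \<le> b"
    using bdd unfolding bdd_above_def by fastforce
  obtain v where v: "Y (int k0) *v v \<noteq> 0"
    using \<open>Y (int k0) \<noteq> 0\<close> by (auto simp: matrix_eq)
  have bound: "norm (shifted_entry lam A k l w) \<le> (cmod lam + c * b) * norm w" for k l w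
  proof -
    have "norm (lam *s w) = cmod lam * norm w"
      by (simp add: norm_vec_def norm_mult L2_set_right_distrib)
    then have "norm (if k = l then lam *s w else 0) \<le> cmod lam * norm w" by simp
    moreover have "norm (A k l *v w) \<le> c * b * norm w"
      using c(2)[of "A k l" w] mult_right_mono[OF mult_left_mono[OF b[of k l], of c], of "norm w"]
        less_imp_le[OF c(1)] norm_ge_zero[of w]
      by (meson order_trans)
    ultimately show ?thesis
      unfolding shifted_entry_def by (intro norm_triangle_le_diff) (simp add: algebra_simps)
  qed
  obtain \<rho> where \<rho>: "\<rho> > 1"
    "\<And>M. \<rho> * (\<Sum>k<M. (norm (Y (int k) *v v))\<^sup>2) \<le> (\<Sum>k<M + 2 * (r + s). (norm (Y (int k) *v v))\<^sup>2)"
    using kernel_partial_sums_grow[where u = "\<lambda>k. Y (int k) *v v",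
        OF shifted_entry_band[OF band] bound right_solution_kernel[OF band sol] below] by blast
  show ?thesis
  proof (rule limsup_root_gt_1_if_partial_sums_grow[OF \<rho>(1) _ \<rho>(2)])
    show "\<bar>norm (Y (int k) *v v)\<bar> \<le> c * norm v * nrm (Y (int k))" for k
      using c(2)[of "Y (int k)" v] by (simp add: algebra_simps)
    show "nrm (Y (int k)) \<ge> 0" for k
      using nrm by (simp add: matrix_norm_def)
  qed (use v \<open>r + s > 0\<close> in auto)
qed

section \<open>Lower bounds from the resolvent\<close>

lemma finite_support_l2:
  assumes "\<And>k. k \<ge> N \<Longrightarrow> u k = 0"
  shows "u \<in> l2" "(l2_norm u)\<^sup>2 = (\<Sum>k<N. (norm (u k))\<^sup>2)"
proof -
  have "(\<lambda>k. (norm (u k))\<^sup>2) sums (\<Sum>k<N. (norm (u k))\<^sup>2)"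
    by (rule sums_finite) (use assms in auto)
  then show "u \<in> l2" "(l2_norm u)\<^sup>2 = (\<Sum>k<N. (norm (u k))\<^sup>2)"
    by (auto simp: l2_def l2_norm_def sums_iff sum_nonneg)
qed

lemma sum_le_l2_norm:
  assumes "u \<in> l2"
  shows "(\<Sum>k<N. (norm (u k))\<^sup>2) \<le> (l2_norm u)\<^sup>2"
  using assms by (auto simp: l2_def l2_norm_def suminf_nonneg intro!: sum_le_suminf)

lemma l2_norm_nonneg: "l2_norm u \<ge> 0" if "u \<in> l2"
  using that by (simp add: l2_def l2_norm_def suminf_nonneg)

lemma shifted_action_finite:
  assumes "\<And>l. l \<ge> N \<Longrightarrow> A k l *v u l = 0" and "k < N \<or> u k = 0"
  shows "shifted_action lam A u k = (\<Sum>l<N. shifted_entry lam A k l (u l))"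
proof -
  have "(\<Sum>l. A k l *v u l) = (\<Sum>l<N. A k l *v u l)"
    by (rule suminf_finite) (use assms in auto)
  moreover have "(\<Sum>l<N. if k = l then lam *s u l else 0) = lam *s u k"
    using assms(2) by (auto simp: sum.delta')
  ultimately show ?thesis
    by (simp add: shifted_action_def matrix_action_def shifted_entry_def sum_subtractf)
qed

text \<open>
  A truncation \<open>w\<close> is recovered as \<open>R ((\<lambda> - A) w)\<close>, so \<open>\<parallel>w\<parallel> \<le> \<parallel>R\<parallel> \<parallel>(\<lambda> - A) w\<parallel>\<close>.
\<close>

lemma resolvent_bounded_below:
  fixes A :: "nat \<Rightarrow> nat \<Rightarrow> 'n::finite cmat"
  assumes band: "band_matrix r s A" and "lam \<in> resolvent_set A"
  shows "\<exists>C. bounded_below_on_truncations (r + s) (shifted_entry lam A) C"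
proof -
  obtain R C where R: "\<And>u. u \<in> l2 \<Longrightarrow> R (shifted_action lam A u) = u"
    and C: "\<And>u. u \<in> l2 \<Longrightarrow> l2_norm (R u) \<le> C * l2_norm u"
    using assms(2) unfolding resolvent_set_def bounded_l2_operator_def by blast
  have "(\<Sum>k<M. (norm (u k))\<^sup>2)
      \<le> C\<^sup>2 * (\<Sum>k<M + (r + s). (norm (\<Sum>l<M. shifted_entry lam A k l (u l)))\<^sup>2)" for u M
  proof -
    define w where "w k = (if k < M then u k else 0)" for k
    define f where "f k = (\<Sum>l<M. shifted_entry lam A k l (u l))" for k
    have w: "w \<in> l2" "(l2_norm w)\<^sup>2 = (\<Sum>k<M. (norm (u k))\<^sup>2)"
      using finite_support_l2[of M w] by (simp_all add: w_def)
    have "shifted_action lam A w = f"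
    proof
      show "shifted_action lam A w k = f k" for k
        by (subst shifted_action_finite[where N = M]) (auto simp: w_def f_def)
    qed
    then have "R f = w" using R[OF w(1)] by simp
    have "f k = 0" if "k \<ge> M + (r + s)" for k
      unfolding f_def using that by (intro sum.neutral) (auto intro: shifted_entry_band[OF band])
    note f = finite_support_l2[of "M + (r + s)" f, OF this]
    have "(l2_norm w)\<^sup>2 \<le> (C * l2_norm f)\<^sup>2"
      using C[OF f(1)] l2_norm_nonneg[OF w(1)] \<open>R f = w\<close> by (intro power_mono) simp_all
    then show ?thesis by (simp add: w f power_mult_distrib) (simp add: f_def)
  qed
  then show ?thesis unfolding bounded_below_on_truncations_def by blast
qed

text \<open>
  The pairing is bilinear, without conjugation, so that the transpose (not the adjoint)
  is dual to \<open>A\<close> and the spectral parameter is not conjugated.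
\<close>

definition bilinear_pairing :: "complex^'n::finite \<Rightarrow> complex^'n \<Rightarrow> complex" where
  "bilinear_pairing x y = (\<Sum>i\<in>UNIV. x $ i * y $ i)"

lemma cmod_bilinear_pairing_le: "cmod (bilinear_pairing x y) \<le> norm x * norm y"
proof -
  have "cmod (bilinear_pairing x y) \<le> (\<Sum>i\<in>UNIV. \<bar>cmod (x $ i)\<bar> * \<bar>cmod (y $ i)\<bar>)"
    unfolding bilinear_pairing_def by (rule sum_norm_le) (simp add: norm_mult)
  also have "\<dots> \<le> norm x * norm y" unfolding norm_vec_def by (rule L2_set_mult_ineq)
  finally show ?thesis .
qed

lemma bilinear_pairing_cnj: "bilinear_pairing x (\<chi> i. cnj (x $ i)) = of_real ((norm x)\<^sup>2)"
  by (simp add: bilinear_pairing_def norm_vec_def L2_set_def sum_nonneg complex_norm_square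
      flip: of_real_power)

lemma bilinear_pairing_sum_left:
  "bilinear_pairing (\<Sum>k\<in>I. f k) y = (\<Sum>k\<in>I. bilinear_pairing (f k) y)"
  unfolding bilinear_pairing_def by (subst sum.swap) (simp add: sum_distrib_right)

lemma bilinear_pairing_sum_right:
  "bilinear_pairing x (\<Sum>k\<in>I. f k) = (\<Sum>k\<in>I. bilinear_pairing x (f k))"
  unfolding bilinear_pairing_def by (subst sum.swap) (simp add: sum_distrib_left)

lemma bilinear_pairing_matrix:
  "bilinear_pairing x (X *v y) = bilinear_pairing (transpose X *v x) y"
proof -
  have "bilinear_pairing x (X *v y) = (\<Sum>i\<in>UNIV. \<Sum>j\<in>UNIV. x $ i * (X $ i $ j * y $ j))"
    by (simp add: bilinear_pairing_def matrix_vector_mult_def sum_distrib_left)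
  also have "\<dots> = (\<Sum>j\<in>UNIV. \<Sum>i\<in>UNIV. x $ i * (X $ i $ j * y $ j))"
    by (rule sum.swap)
  also have "\<dots> = bilinear_pairing (transpose X *v x) y"
    by (simp add: bilinear_pairing_def vector_matrix_mult_def sum_distrib_left mult_ac)
  finally show ?thesis .
qed

lemma bilinear_pairing_shifted_entry:
  fixes A :: "nat \<Rightarrow> nat \<Rightarrow> 'n::finite cmat"
  shows "bilinear_pairing x (shifted_entry lam A k l y)
    = bilinear_pairing (shifted_entry lam (\<lambda>k l. transpose (A l k)) l k x) y"
proof -
  have "bilinear_pairing x (y - z) = bilinear_pairing x y - bilinear_pairing x z"
    "bilinear_pairing (y - z) x = bilinear_pairing y x - bilinear_pairing z x"
    "bilinear_pairing x (lam *s y) = bilinear_pairing (lam *s x) y"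
    "bilinear_pairing x 0 = 0" "bilinear_pairing 0 x = 0" for x y z :: "complex^'n"
    by (simp_all add: bilinear_pairing_def algebra_simps sum_subtractf)
  then show ?thesis
    by (simp add: shifted_entry_def bilinear_pairing_matrix del: transpose_matrix_vector)
qed

text \<open>
  Write \<open>w\<close> for the truncation of \<open>u\<close> and \<open>x\<close> for its conjugate, and solve \<open>(\<lambda> - A) v = x\<close> by \<open>v = R x\<close>.
  Then \<open>\<parallel>w\<parallel>\<^sup>2 = \<langle>w, x\<rangle> = \<langle>w, (\<lambda> - A) v\<rangle> = \<langle>(\<lambda> - A\<^sup>T) w, v\<rangle> \<le> \<parallel>(\<lambda> - A\<^sup>T) w\<parallel> \<parallel>R\<parallel> \<parallel>w\<parallel>\<close>. Since \<open>w\<close> has finite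
  support and \<open>A\<close> is banded, moving \<open>A\<close> to the other side only exchanges finite sums.
\<close>

lemma resolvent_transpose_bounded_below:
  fixes A :: "nat \<Rightarrow> nat \<Rightarrow> 'n::finite cmat"
  assumes band: "band_matrix r s A" and "lam \<in> resolvent_set A"
  shows "\<exists>C. bounded_below_on_truncations (r + s) (shifted_entry lam (\<lambda>k l. transpose (A l k))) C"
proof -
  obtain R C where R: "\<And>u. u \<in> l2 \<Longrightarrow> shifted_action lam A (R u) = u"
    and R_l2: "\<And>u. u \<in> l2 \<Longrightarrow> R u \<in> l2"
    and C: "\<And>u. u \<in> l2 \<Longrightarrow> l2_norm (R u) \<le> C * l2_norm u"
    using assms(2) unfolding resolvent_set_def bounded_l2_operator_def by blast
  let ?T = "shifted_entry lam (\<lambda>k l. transpose (A l k))"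
  have "(\<Sum>k<M. (norm (u k))\<^sup>2) \<le> C\<^sup>2 * (\<Sum>l<M + (r + s). (norm (\<Sum>k<M. ?T l k (u k)))\<^sup>2)" for u M
  proof -
    define N where "N = M + (r + s)"
    define S where "S = (\<Sum>k<M. (norm (u k))\<^sup>2)"
    define f where "f l = (\<Sum>k<M. ?T l k (u k))" for l
    define F where "F = (\<Sum>l<N. (norm (f l))\<^sup>2)"
    define x where "x k = (if k < M then \<chi> i. cnj (u k $ i) else 0)" for k
    define v where "v = R x"
    have "norm (\<chi> i. cnj (y $ i)) = norm y" for y :: "complex^'n"
      by (simp add: norm_vec_def)
    then have x: "x \<in> l2" "(l2_norm x)\<^sup>2 = S"
      using finite_support_l2[of M x] by (simp_all add: x_def S_def)
    have "v \<in> l2" unfolding v_def by (rule R_l2[OF x(1)])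
    have v_row: "x k = (\<Sum>l<N. shifted_entry lam A k l (v l))" if "k < M" for k
    proof -
      have "A k l = 0" if "l \<ge> N" for l
        using band \<open>k < M\<close> that by (auto simp: band_matrix_def N_def)
      then have "shifted_action lam A v k = (\<Sum>l<N. shifted_entry lam A k l (v l))"
        by (intro shifted_action_finite) (use that in \<open>auto simp: N_def\<close>)
      then show ?thesis using R[OF x(1)] by (simp add: v_def)
    qed
    have "complex_of_real S = (\<Sum>k<M. bilinear_pairing (u k) (x k))"
      by (simp add: S_def x_def bilinear_pairing_cnj)
    also have "\<dots> = (\<Sum>k<M. \<Sum>l<N. bilinear_pairing (?T l k (u k)) (v l))"
      by (intro sum.cong refl)
         (simp add: v_row bilinear_pairing_sum_right bilinear_pairing_shifted_entry)
    also have "\<dots> = (\<Sum>l<N. bilinear_pairing (f l) (v l))"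
      unfolding f_def bilinear_pairing_sum_left by (rule sum.swap)
    finally have S_eq: "complex_of_real S = (\<Sum>l<N. bilinear_pairing (f l) (v l))" .
    have "S \<ge> 0" unfolding S_def by (intro sum_nonneg) simp
    then have "S = cmod (\<Sum>l<N. bilinear_pairing (f l) (v l))"
      unfolding S_eq[symmetric] by simp
    also have "\<dots> \<le> (\<Sum>l<N. norm (f l) * norm (v l))"
      by (intro sum_norm_le cmod_bilinear_pairing_le)
    finally have "S\<^sup>2 \<le> (\<Sum>l<N. norm (f l) * norm (v l))\<^sup>2"
      using \<open>S \<ge> 0\<close> by (intro power_mono)
    also have "\<dots> \<le> F * (\<Sum>l<N. (norm (v l))\<^sup>2)"
      unfolding F_def by (rule Cauchy_Schwarz_ineq_sum)
    also have "\<dots> \<le> F * (l2_norm v)\<^sup>2"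
      using sum_le_l2_norm[OF \<open>v \<in> l2\<close>] by (intro mult_left_mono) (simp_all add: F_def sum_nonneg)
    also have "\<dots> \<le> F * (C * l2_norm x)\<^sup>2"
      using C[OF x(1)] l2_norm_nonneg[OF \<open>v \<in> l2\<close>]
      by (intro mult_left_mono power_mono) (simp_all add: v_def F_def sum_nonneg)
    also have "\<dots> = C\<^sup>2 * F * S" by (simp add: power_mult_distrib x)
    finally have "S * S \<le> C\<^sup>2 * F * S" by (simp add: power2_eq_square)
    moreover have "C\<^sup>2 * F \<ge> 0" by (simp add: F_def sum_nonneg)
    ultimately have "S \<le> C\<^sup>2 * F" using \<open>S \<ge> 0\<close> by (cases "S = 0") (simp_all add: mult_le_cancel_right)
    then show ?thesis by (simp add: S_def F_def f_def N_def)
  qed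
  then show ?thesis unfolding bounded_below_on_truncations_def by blast
qed

section \<open>Transposition\<close>

lemma invertible_transpose: "invertible (transpose X)" if "invertible X" for X :: "'n::finite cmat"
proof -
  from that obtain Z where Z: "X ** Z = mat 1" "Z ** X = mat 1"
    unfolding invertible_def by blast
  have "transpose X ** transpose Z = mat 1" "transpose Z ** transpose X = mat 1"
    by (simp_all only: matrix_transpose_mul[symmetric] Z transpose_mat)
  then show ?thesis unfolding invertible_def by blast
qed

lemma band_matrix_transpose:
  assumes "band_matrix r s A"
  shows "band_matrix s r (\<lambda>k l. transpose (A l k))"
  using assms by (auto simp: band_matrix_def invertible_transpose transpose_0)

text \<open>
  Transposition exchanges the two rules for entries with one negative index, so it carries
  the boundary conditions of the left equation over to those of the right one.
\<close>

lemma ext_entry_transpose: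
  "ext_entry s r (\<lambda>k l. transpose (A l k)) k l = transpose (ext_entry r s A l k)"
  by (cases "0 \<le> k"; cases "0 \<le> l"; cases "k - l = int r"; cases "l - k = int s";
      simp only: ext_entry_def transpose_0 transpose_uminus transpose_mat not_le[symmetric]
        if_True if_False simp_thms)

lemma left_solution_transpose:
  assumes "left_solution r s A lam Y"
  shows "right_solution s r (\<lambda>k l. transpose (A l k)) lam (\<lambda>k. transpose (Y k))"
  using assms unfolding right_solution_def left_solution_def ext_entry_transpose
    matrix_transpose_mul[symmetric] transpose_mscale[symmetric] transpose_sum[symmetric]
  by metis

lemma mat_1_ne_0: "(mat 1 :: 'n::finite cmat) \<noteq> 0"
proof
  assume "(mat 1 :: 'n cmat) = 0"
  then have "(mat 1 :: 'n cmat) $ i $ i = 0" for i by (simp only: zero_index)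
  then show False by (simp add: mat_def)
qed

theorem theorem2:
  fixes r s :: nat
    and nrm :: "complex^'n::finite^'n \<Rightarrow> real"
    and A :: "nat \<Rightarrow> nat \<Rightarrow> complex^'n^'n"
    and Q Qp :: "nat \<Rightarrow> complex \<Rightarrow> int \<Rightarrow> complex^'n^'n"
    and lam :: complex
  assumes "r \<ge> 1" and "s \<ge> 1"
    and "matrix_norm nrm"
    and "band_matrix r s A"
    and "bdd_above (range (\<lambda>(i, j). nrm (A i j)))"
    and "right_fundamental r s A Q"
    and "left_fundamental r s A Qp"
    and "lam \<in> resolvent_set A"
  shows "(\<forall>i\<in>{1..r}. limsup (\<lambda>k. ereal (root k (nrm (Q i lam (int k))))) > 1) \<and>
         (\<forall>j\<in>{1..s}. limsup (\<lambda>k. ereal (root k (nrm (Qp j lam (int k))))) > 1)"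
proof (intro conjI ballI)
  fix i assume i: "i \<in> {1..r}"
  obtain C where C: "bounded_below_on_truncations (r + s) (shifted_entry lam A) C"
    using resolvent_bounded_below assms by blast
  have Q: "right_solution r s A lam (Q i lam)" "\<forall>k\<in>{- int s..-1}. Q i lam k = 0"
    and "\<forall>k<r. Q i lam (int k) = (if k + 1 = i then mat 1 else 0)"
    using assms(6) i unfolding right_fundamental_def by blast+
  moreover have "i - 1 < r" "i - 1 + 1 = i" using i by auto
  ultimately have "Q i lam (int (i - 1)) = mat 1" by metis
  then have "Q i lam (int (i - 1)) \<noteq> 0" by (simp only: mat_1_ne_0) simp
  from limsup_root_right_solution_gt_1[OF _ assms(3-5) Q this C] \<open>r \<ge> 1\<close>
  show "limsup (\<lambda>k. ereal (root k (nrm (Q i lam (int k))))) > 1" by simp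
next
  fix j assume j: "j \<in> {1..s}"
  let ?A = "\<lambda>k l. transpose (A l k)" and ?nrm = "\<lambda>X. nrm (transpose X)"
    and ?Y = "\<lambda>k. transpose (Qp j lam k)"
  obtain C where "bounded_below_on_truncations (r + s) (shifted_entry lam ?A) C"
    using resolvent_transpose_bounded_below assms by blast
  then have C: "bounded_below_on_truncations (s + r) (shifted_entry lam ?A) C"
    by (simp add: add.commute)
  have Qp: "left_solution r s A lam (Qp j lam)" "\<forall>k\<in>{- int r..-1}. Qp j lam k = 0"
    and "\<forall>k<s. Qp j lam (int k) = (if k + 1 = j then mat 1 else 0)"
    using assms(7) j unfolding left_fundamental_def by blast+
  moreover have "j - 1 < s" "j - 1 + 1 = j" using j by auto
  ultimately have "Qp j lam (int (j - 1)) = mat 1" by metis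
  then have nonzero: "?Y (int (j - 1)) \<noteq> 0" by (simp only: transpose_mat mat_1_ne_0) simp
  have init: "\<forall>k\<in>{- int r..-1}. ?Y k = 0" using Qp(2) by (simp add: transpose_0)
  have "range (\<lambda>(i, j). ?nrm (?A i j)) = range (\<lambda>(i, j). nrm (A i j))"
    unfolding transpose_transpose by fast
  then have bdd: "bdd_above (range (\<lambda>(i, j). ?nrm (?A i j)))"
    using assms(5) by (simp only:)
  from limsup_root_right_solution_gt_1[OF _ matrix_norm_transpose[OF assms(3)]
      band_matrix_transpose[OF assms(4)] bdd left_solution_transpose[OF Qp(1)] init nonzero C]
    \<open>r \<ge> 1\<close>
  show "limsup (\<lambda>k. ereal (root k (nrm (Qp j lam (int k))))) > 1" by simp
qed

end
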